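(* Let $\gamma_l,\gamma_r:\mathbb{R}\to\mathbb{R}$ be non-decreasing and Lipschitz continuous with $\gamma_r\le\gamma_l$, and let $\mathcal{H}$ be the generalized play operator with hysteresis boundary curves $\gamma_l,\gamma_r$. Let $K>0$ and let $u_0,w_0\in\mathbb{R}$ with $\gamma_r(u_0)\le w_0\le\gamma_l(u_0)$. Suppose $r(t)=R$ for all $t\ge0$, and let $u$ be the solution of the Cauchy problem $$\frac1K\frac{du}{dt}(t)+\mathcal{H}(u,w_0)(t)=r(t),\quad t\ge 0,\qquad u(0)=u_0,\quad \mathcal{H}(u,w_0)(0)=w_0.$$ Suppose $0<R<H$, where $H>0$ is a constant such that $0\le\mathcal{H}(u,w_0)(t)\le H$ for all $t\ge 0$. Then the solution $u(t)$ is stable. Moreover, let $u_1$ be the highest value of $u$ for which $\gamma_l(u)=R$ and let $u_2$ be the smallest value of $u$ for which $\gamma_r(u)=R$. Then, depending on the initial conditions, the solution $u(t)$ converges (as $t\to\infty$) to some $u_*$ from the set $\{u_1,u_2\}$.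
   Context: Generalized play operator. Let $\gamma_l,\gamma_r:\mathbb{R}\to\mathbb{R}$ be continuous non-decreasing functions with $\gamma_r\le\gamma_l$. For a continuous piecewise linear function $u$ on $\mathbb{R}^+=[0,\infty)$, linear on each $[t_{i-1},t_i]$, $i=1,2,\dots$ (with $0=t_0<t_1<\cdots$), and $w_0\in\mathbb{R}$, define $w=\mathcal{H}(u,w_0):\mathbb{R}^+\to\mathbb{R}$ by $w(0)=\min\{\gamma_l(u(0)),\max\{\gamma_r(u(0)),w_0\}\}$ and $w(t)=\min\{\gamma_l(u(t)),\max\{\gamma_r(u(t)),w(t_{i-1})\}\}$ for $t\in(t_{i-1},t_i]$. It is assumed that $\gamma_r(u(0))\le w_0\le\gamma_l(u(0))$, so that $w(0)=w_0$. This operator has a unique continuous extension (with respect to uniform convergence on compact intervals) to $\mathcal{H}:C(\mathbb{R}^+)\times\mathbb{R}\to C(\mathbb{R}^+)$, called the generalized play operator with hysteresis boundary curves $\gamma_l,\gamma_r$. A solution of the Cauchy problem is a function $u$ on $[0,\infty)$, differentiable (one-sided at $0$), satisfying the equation for all $t\ge0$ and the initial conditions. "Stable" is read in the Lyapunov sense: for every $\varepsilon>0$ there is $\delta>0$ such that every solution $\tilde u$ of the same equation whose admissible initial data $(\tilde u_0,\tilde w_0)$ satisfy $|\tilde u_0-u_0|+|\tilde w_0-w_0|<\delta$ satisfies $|\tilde u(t)-u(t)|<\varepsilon$ for all $t\ge0$.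
   Formalization: The formal theorem assumes w_0 ≠ R (for w_0 = R the solution is constant, in general unstable and not converging to u_1 or u_2), and assumes that u_1 and u_2 exist for the stability claim too, which can fail without them. *)

theory Defs
  imports "HOL-Analysis.Analysis"
begin

text \<open>
  Inputs and outputs are functions \<^typ>\<open>real \<Rightarrow> real\<close> of which only the restriction
  to \<^term>\<open>{0::real..}\<close> matters.
\<close>

definition pw_linear_on_grid :: "(nat \<Rightarrow> real) \<Rightarrow> (real \<Rightarrow> real) \<Rightarrow> bool" where
  "pw_linear_on_grid \<tau> u \<longleftrightarrow>
     \<tau> 0 = 0 \<and> strict_mono \<tau> \<and> filterlim \<tau> at_top sequentially \<and>
     (\<forall>i. \<exists>a b. \<forall>t\<in>{\<tau> i..\<tau> (Suc i)}. u t = a + b * t)"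

definition play_on_grid ::
  "(real \<Rightarrow> real) \<Rightarrow> (real \<Rightarrow> real) \<Rightarrow> (nat \<Rightarrow> real) \<Rightarrow> (real \<Rightarrow> real) \<Rightarrow> real \<Rightarrow> (real \<Rightarrow> real) \<Rightarrow> bool" where
  "play_on_grid \<gamma>l \<gamma>r \<tau> u w0 w \<longleftrightarrow>
     w 0 = min (\<gamma>l (u 0)) (max (\<gamma>r (u 0)) w0) \<and>
     (\<forall>i. \<forall>t\<in>{\<tau> i<..\<tau> (Suc i)}. w t = min (\<gamma>l (u t)) (max (\<gamma>r (u t)) (w (\<tau> i))))"

text \<open>
  \<open>H\<close> maps continuous inputs to continuous outputs, agrees with the recursion on piecewise
  linear inputs, and is continuous for uniform convergence on compact intervals in \<open>u\<close> and
  ordinary convergence in \<open>w0\<close>; that topology is metrizable, so sequential continuity suffices.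
\<close>

definition is_generalized_play ::
  "(real \<Rightarrow> real) \<Rightarrow> (real \<Rightarrow> real) \<Rightarrow> ((real \<Rightarrow> real) \<Rightarrow> real \<Rightarrow> real \<Rightarrow> real) \<Rightarrow> bool" where
  "is_generalized_play \<gamma>l \<gamma>r H \<longleftrightarrow>
     (\<forall>u w0. continuous_on {0..} u \<longrightarrow> continuous_on {0..} (H u w0)) \<and>
     (\<forall>\<tau> u w0 w. pw_linear_on_grid \<tau> u \<longrightarrow> play_on_grid \<gamma>l \<gamma>r \<tau> u w0 w \<longrightarrow> (\<forall>t\<ge>0. H u w0 t = w t)) \<and>
     (\<forall>U u a w0. (\<forall>n. continuous_on {0..} (U n)) \<longrightarrow> continuous_on {0..} u \<longrightarrow>
        (\<forall>T. uniform_limit {0..T} U u sequentially) \<longrightarrow> a \<longlonglongrightarrow> w0 \<longrightarrow>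
        (\<forall>T. uniform_limit {0..T} (\<lambda>n. H (U n) (a n)) (H u w0) sequentially))"

text \<open>
  For continuous non-decreasing boundary curves \<open>\<gamma>r \<le> \<gamma>l\<close> such an operator exists and is unique as an operator on
  \<^term>\<open>{0::real..}\<close> (proved below); the choice operator only fixes the irrelevant
  values at negative times and at discontinuous inputs.
\<close>

definition generalized_play ::
  "(real \<Rightarrow> real) \<Rightarrow> (real \<Rightarrow> real) \<Rightarrow> (real \<Rightarrow> real) \<Rightarrow> real \<Rightarrow> real \<Rightarrow> real" where
  "generalized_play \<gamma>l \<gamma>r = (SOME H. is_generalized_play \<gamma>l \<gamma>r H)"

text \<open>
  Solutions of \<open>(1/K) u' + H(u,w0) = r\<close> with \<open>u(0) = u0\<close> and \<open>H(u,w0)(0) = w0\<close>; the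
  derivative within \<^term>\<open>{0::real..}\<close> is two-sided at positive times and one-sided at 0.
  For \<open>r = R\<close> and \<open>w0 = R\<close> every \<open>u0\<close> with \<open>\<gamma>r u0 \<le> R \<le> \<gamma>l u0\<close> is an equilibrium, in general neither
  Lyapunov stable nor an endpoint of that equilibrium range; this is why stability and convergence
  to an endpoint are only claimed for \<open>w0 \<noteq> R\<close>.
\<close>

definition play_cauchy_solution ::
  "(real \<Rightarrow> real) \<Rightarrow> (real \<Rightarrow> real) \<Rightarrow> real \<Rightarrow> (real \<Rightarrow> real) \<Rightarrow> real \<Rightarrow> real \<Rightarrow> (real \<Rightarrow> real) \<Rightarrow> bool" where
  "play_cauchy_solution \<gamma>l \<gamma>r K r u0 w0 u \<longleftrightarrow>
     (\<forall>t\<ge>0. \<exists>D. (u has_real_derivative D) (at t within {0..}) \<and>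
               1 / K * D + generalized_play \<gamma>l \<gamma>r u w0 t = r t) \<and>
     u 0 = u0 \<and> generalized_play \<gamma>l \<gamma>r u w0 0 = w0"

definition lyapunov_stable_solution ::
  "(real \<Rightarrow> real) \<Rightarrow> (real \<Rightarrow> real) \<Rightarrow> real \<Rightarrow> (real \<Rightarrow> real) \<Rightarrow> real \<Rightarrow> real \<Rightarrow> (real \<Rightarrow> real) \<Rightarrow> bool" where
  "lyapunov_stable_solution \<gamma>l \<gamma>r K r u0 w0 u \<longleftrightarrow>
     (\<forall>\<epsilon>>0. \<exists>\<delta>>0. \<forall>v0 z0 v.
        \<gamma>r v0 \<le> z0 \<longrightarrow> z0 \<le> \<gamma>l v0 \<longrightarrow> \<bar>v0 - u0\<bar> + \<bar>z0 - w0\<bar> < \<delta> \<longrightarrow>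
        play_cauchy_solution \<gamma>l \<gamma>r K r v0 z0 v \<longrightarrow> (\<forall>t\<ge>0. \<bar>v t - u t\<bar> < \<epsilon>))"

subsection \<open>Existence of the generalized play operator\<close>

text \<open>
  The extension is given by the explicit two-sided reflection formula
  \<open>max (min w0 (inf\<^bsub>[0,t]\<^esub> L)) (sup\<^bsub>s \<le> t\<^esub> (min (R s) (inf\<^bsub>[s,t]\<^esub> L)))\<close> with \<open>L = \<gamma>l \<circ> u\<close> and
  \<open>R = \<gamma>r \<circ> u\<close>, written as the supremum of its lower set.
\<close>

definition reflect_lower :: "(real \<Rightarrow> real) \<Rightarrow> (real \<Rightarrow> real) \<Rightarrow> real \<Rightarrow> real \<Rightarrow> real set" where
  "reflect_lower L R a t =
     {c. (c \<le> a \<and> (\<forall>q\<in>{0..t}. c \<le> L q)) \<or> (\<exists>s\<in>{0..t}. c \<le> R s \<and> (\<forall>q\<in>{s..t}. c \<le> L q))}"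

definition reflect :: "(real \<Rightarrow> real) \<Rightarrow> (real \<Rightarrow> real) \<Rightarrow> real \<Rightarrow> real \<Rightarrow> real" where
  "reflect L R a t = Sup (reflect_lower L R a t)"

lemma reflect_lowerI1: "c \<in> reflect_lower L R a t"
  if "c \<le> a" "\<And>q. 0 \<le> q \<Longrightarrow> q \<le> t \<Longrightarrow> c \<le> L q"
  using that by (simp add: reflect_lower_def)

lemma reflect_lowerI2: "c \<in> reflect_lower L R a t"
  if "0 \<le> s" "s \<le> t" "c \<le> R s" "\<And>q. s \<le> q \<Longrightarrow> q \<le> t \<Longrightarrow> c \<le> L q"
proof -
  have "\<exists>s\<in>{0..t}. c \<le> R s \<and> (\<forall>q\<in>{s..t}. c \<le> L q)"
    by (rule bexI[of _ s]) (use that in auto)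
  then show ?thesis by (simp add: reflect_lower_def)
qed

lemma reflect_lowerE:
  assumes "c \<in> reflect_lower L R a t"
  obtains "c \<le> a" "\<And>q. 0 \<le> q \<Longrightarrow> q \<le> t \<Longrightarrow> c \<le> L q"
  | s where "0 \<le> s" "s \<le> t" "c \<le> R s" "\<And>q. s \<le> q \<Longrightarrow> q \<le> t \<Longrightarrow> c \<le> L q"
proof -
  have "(c \<le> a \<and> (\<forall>q\<in>{0..t}. c \<le> L q)) \<or> (\<exists>s\<in>{0..t}. c \<le> R s \<and> (\<forall>q\<in>{s..t}. c \<le> L q))"
    using assms unfolding reflect_lower_def by (rule CollectD)
  then show thesis
  proof
    assume "c \<le> a \<and> (\<forall>q\<in>{0..t}. c \<le> L q)"
    then show thesis by (intro that(1)) simp_all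
  next
    assume "\<exists>s\<in>{0..t}. c \<le> R s \<and> (\<forall>q\<in>{s..t}. c \<le> L q)"
    then obtain s where "s \<in> {0..t}" "c \<le> R s" "\<forall>q\<in>{s..t}. c \<le> L q" by blast
    then show thesis by (intro that(2)[of s]) simp_all
  qed
qed

text \<open>A member at a later time either is already a member earlier or is created in between.\<close>

lemma reflect_lower_split:
  assumes "c \<in> reflect_lower L R a t" "0 \<le> p" "p \<le> t"
  obtains "c \<in> reflect_lower L R a p"
  | s where "p \<le> s" "s \<le> t" "c \<le> R s"
  using assms(1)
proof (cases rule: reflect_lowerE)
  case 1
  have "c \<in> reflect_lower L R a p" by (rule reflect_lowerI1) (use 1 assms(3) in auto)
  then show thesis by (rule that(1))
next
  case (2 s)
  show thesis
  proof (cases "p \<le> s")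
    case True
    then show thesis using that(2) 2 by blast
  next
    case False
    have "c \<in> reflect_lower L R a p"
      by (rule reflect_lowerI2[of s]) (use 2 assms(3) False in auto)
    then show thesis by (rule that(1))
  qed
qed

lemma reflect_lower_extend:
  assumes c: "c \<in> reflect_lower L R a p" and "d \<le> c" "p \<le> t"
    and L: "\<And>q. p \<le> q \<Longrightarrow> q \<le> t \<Longrightarrow> d \<le> L q"
  shows "d \<in> reflect_lower L R a t"
  using c
proof (cases rule: reflect_lowerE)
  case 1
  show ?thesis
  proof (rule reflect_lowerI1)
    show "d \<le> a" using 1 assms(2) by simp
    show "d \<le> L q" if "0 \<le> q" "q \<le> t" for q
      using that L[of q] 1(2)[of q] assms(2) by (cases "q \<le> p") auto
  qed
next
  case (2 s)
  show ?thesis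
  proof (rule reflect_lowerI2[of s])
    show "d \<le> R s" "0 \<le> s" "s \<le> t" using 2 assms(2,3) by auto
    show "d \<le> L q" if "s \<le> q" "q \<le> t" for q
      using that L[of q] 2(4)[of q] assms(2) by (cases "q \<le> p") auto
  qed
qed

lemma reflect_lower_bound: "c \<le> L t" if "c \<in> reflect_lower L R a t" "0 \<le> t"
  using that(1) by (cases rule: reflect_lowerE) (use that(2) in auto)

lemma reflect_ge: "c \<le> reflect L R a t" if "c \<in> reflect_lower L R a t" "0 \<le> t"
  unfolding reflect_def
  by (rule cSup_upper[OF that(1) bdd_aboveI[of _ "L t"]]) (rule reflect_lower_bound[OF _ that(2)])

lemma reflect_R_mem: "R t \<in> reflect_lower L R a t" if "0 \<le> t" "R t \<le> L t"
  by (rule reflect_lowerI2[of t]) (use that in auto)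

lemma reflect_le: "reflect L R a t \<le> x"
  if "0 \<le> t" "R t \<le> L t" "\<And>c. c \<in> reflect_lower L R a t \<Longrightarrow> c \<le> x"
proof -
  have "reflect_lower L R a t \<noteq> {}" using reflect_R_mem[of t R L a, OF that(1,2)] by blast
  then show ?thesis unfolding reflect_def by (rule cSup_least) (rule that(3))
qed

lemma reflect_close:
  assumes "0 \<le> t" and RL: "\<And>s. 0 \<le> s \<Longrightarrow> R s \<le> L s"
    and "\<And>s. s \<in> {0..t} \<Longrightarrow> L s \<le> L' s + e" "\<And>s. s \<in> {0..t} \<Longrightarrow> R s \<le> R' s + e" "a \<le> a' + e"
  shows "reflect L R a t \<le> reflect L' R' a' t + e"
proof (rule reflect_le)
  fix c assume c: "c \<in> reflect_lower L R a t"
  have "c - e \<in> reflect_lower L' R' a' t"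
    using c
  proof (cases rule: reflect_lowerE)
    case 1
    show ?thesis
    proof (rule reflect_lowerI1)
      show "c - e \<le> a'" using 1(1) assms(5) by linarith
      show "c - e \<le> L' q" if "0 \<le> q" "q \<le> t" for q
        using 1(2)[OF that] assms(3)[of q] that by auto
    qed
  next
    case (2 s)
    show ?thesis
    proof (rule reflect_lowerI2[of s])
      show "c - e \<le> R' s" using 2 assms(4)[of s] by auto
      show "c - e \<le> L' q" if "s \<le> q" "q \<le> t" for q
        using 2(1) 2(4)[OF that] assms(3)[of q] that by auto
    qed (use 2 in auto)
  qed
  from reflect_ge[OF this \<open>0 \<le> t\<close>] show "c \<le> reflect L' R' a' t + e" by simp
qed (use assms in auto)

lemma reflect_time:
  assumes "0 \<le> p" "p \<le> t" and RL: "\<And>s. 0 \<le> s \<Longrightarrow> R s \<le> L s" and "0 \<le> e"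
    and Lc: "\<And>s. s \<in> {p..t} \<Longrightarrow> \<bar>L s - L p\<bar> \<le> e" and Rc: "\<And>s. s \<in> {p..t} \<Longrightarrow> \<bar>R s - R p\<bar> \<le> e"
  shows "\<bar>reflect L R a t - reflect L R a p\<bar> \<le> e"
proof -
  have "reflect L R a t \<le> reflect L R a p + e"
  proof (rule reflect_le)
    fix c assume c: "c \<in> reflect_lower L R a t"
    have "c - e \<in> reflect_lower L R a p"
      using c assms(1,2)
    proof (cases rule: reflect_lower_split)
      case 1
      show ?thesis
        by (rule reflect_lower_extend[OF 1]) (use reflect_lower_bound[OF 1] assms(1,4) in auto)
    next
      case (2 s)
      have "c - e \<le> R p" using Rc[of s] 2 by auto
      then show ?thesis
        by (intro reflect_lowerI2[of p]) (use RL[of p] assms(1) in auto)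
    qed
    from reflect_ge[OF this] assms(1) show "c \<le> reflect L R a p + e" by auto
  qed (use assms in auto)
  moreover have "reflect L R a p \<le> reflect L R a t + e"
  proof (rule reflect_le)
    fix c assume c: "c \<in> reflect_lower L R a p"
    have "c \<le> L p" using reflect_lower_bound[OF c] assms(1) by auto
    then have *: "c - e \<le> L q" if "q \<in> {p..t}" for q using Lc[OF that] by auto
    have "c - e \<in> reflect_lower L R a t"
      by (rule reflect_lower_extend[OF c]) (use * assms(2,4) in auto)
    from reflect_ge[OF this] assms(1,2) show "c \<le> reflect L R a t + e" by auto
  qed (use assms in auto)
  ultimately show ?thesis by auto
qed

lemma reflect_zero:
  assumes "R 0 \<le> L 0"
  shows "reflect L R a 0 = min (L 0) (max (R 0) a)"
proof (rule antisym)
  show "reflect L R a 0 \<le> min (L 0) (max (R 0) a)"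
  proof (rule reflect_le)
    fix c assume c: "c \<in> reflect_lower L R a 0"
    then have "c \<le> L 0" by (rule reflect_lower_bound) simp
    moreover from c have "c \<le> max (R 0) a" by (cases rule: reflect_lowerE) auto
    ultimately show "c \<le> min (L 0) (max (R 0) a)" by simp
  qed (use assms in auto)
  have "min (L 0) (max (R 0) a) \<in> reflect_lower L R a 0"
  proof (cases "R 0 \<le> a")
    case True
    show ?thesis by (rule reflect_lowerI1) (use True in auto)
  next
    case False
    show ?thesis by (rule reflect_lowerI2[of 0]) (use False in auto)
  qed
  then show "min (L 0) (max (R 0) a) \<le> reflect L R a 0" by (rule reflect_ge) simp
qed

lemma reflect_incr:
  assumes "0 \<le> p" "p \<le> t" and RL: "\<And>s. 0 \<le> s \<Longrightarrow> R s \<le> L s"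
    and L: "mono_on {p..t} L" and R: "mono_on {p..t} R"
  shows "reflect L R a t = min (L t) (max (R t) (reflect L R a p))"
proof -
  have Lp: "reflect L R a p \<le> L p"
    by (rule reflect_le) (use assms reflect_lower_bound in auto)
  have LL: "L p \<le> L q" if "q \<in> {p..t}" for q using mono_onD[OF L, of p q] that assms by auto
  have 1: "reflect L R a t \<le> max (R t) (reflect L R a p)"
  proof (rule reflect_le)
    fix c assume c: "c \<in> reflect_lower L R a t"
    show "c \<le> max (R t) (reflect L R a p)"
      using c assms(1,2)
    proof (cases rule: reflect_lower_split)
      case 1
      then show ?thesis using reflect_ge[OF 1] assms(1) by auto
    next
      case (2 s)
      then have "R s \<le> R t" using mono_onD[OF R, of s t] by auto
      then show ?thesis using 2 by auto
    qed
  qed (use assms in auto)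
  have 2: "reflect L R a p \<le> reflect L R a t"
  proof (rule reflect_le)
    fix c assume c: "c \<in> reflect_lower L R a p"
    have "c \<le> L p" using reflect_lower_bound[OF c] assms(1) by auto
    then have "c \<in> reflect_lower L R a t"
      by (intro reflect_lower_extend[OF c]) (use LL assms(2) in \<open>auto intro: order_trans\<close>)
    then show "c \<le> reflect L R a t" using reflect_ge assms by auto
  qed (use assms in auto)
  have 3: "R t \<le> reflect L R a t" using reflect_ge[OF reflect_R_mem[of t R L a]] assms by auto
  have 4: "reflect L R a t \<le> L t" by (rule reflect_le) (use assms reflect_lower_bound in auto)
  show ?thesis using 1 2 3 4 by auto
qed

lemma reflect_decr:
  assumes "0 \<le> p" "p \<le> t" and RL: "\<And>s. 0 \<le> s \<Longrightarrow> R s \<le> L s"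
    and L: "antimono_on {p..t} L" and R: "antimono_on {p..t} R"
  shows "reflect L R a t = min (L t) (max (R t) (reflect L R a p))"
proof -
  have LL: "L t \<le> L q" if "q \<in> {p..t}" for q using monotone_onD[OF L, of q t] that assms by auto
  have Rp: "R p \<le> reflect L R a p" using reflect_ge[OF reflect_R_mem[of p R L a]] assms by auto
  have 1: "reflect L R a t \<le> reflect L R a p"
  proof (rule reflect_le)
    fix c assume c: "c \<in> reflect_lower L R a t"
    show "c \<le> reflect L R a p"
      using c assms(1,2)
    proof (cases rule: reflect_lower_split)
      case 1
      then show ?thesis using reflect_ge[OF 1] assms(1) by auto
    next
      case (2 s)
      then have "R s \<le> R p" using monotone_onD[OF R, of p s] by auto
      then show ?thesis using 2 Rp by auto
    qed
  qed (use assms in auto)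
  have 2: "reflect L R a p \<le> reflect L R a t" if "reflect L R a t < L t"
  proof (rule reflect_le)
    fix c assume c: "c \<in> reflect_lower L R a p"
    have "min c (L t) \<in> reflect_lower L R a t"
      by (rule reflect_lower_extend[OF c]) (use LL assms(2) in \<open>auto simp: min_le_iff_disj\<close>)
    then have "min c (L t) \<le> reflect L R a t" using reflect_ge assms by auto
    then show "c \<le> reflect L R a t" using that by auto
  qed (use assms in auto)
  have 3: "R t \<le> reflect L R a t" using reflect_ge[OF reflect_R_mem[of t R L a]] assms by auto
  have 4: "reflect L R a t \<le> L t" by (rule reflect_le) (use assms reflect_lower_bound in auto)
  have 5: "R t \<le> reflect L R a p" using 1 3 by auto
  show ?thesis using 1 2 3 4 5 by (cases "reflect L R a t < L t") auto
qed

lemma pw_linear_segment: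
  assumes "pw_linear_on_grid \<tau> u" "0 < t"
  obtains i where "t \<in> {\<tau> i<..\<tau> (Suc i)}"
proof -
  have lim: "filterlim \<tau> at_top sequentially" and \<tau>0: "\<tau> 0 = 0"
    using assms by (auto simp: pw_linear_on_grid_def)
  then have "eventually (\<lambda>n. t \<le> \<tau> n) sequentially" by (auto simp: filterlim_at_top)
  then have ex: "\<exists>n. t \<le> \<tau> n" by (auto simp: eventually_sequentially)
  define n where "n = (LEAST n. t \<le> \<tau> n)"
  have n: "t \<le> \<tau> n" unfolding n_def using ex by (rule LeastI_ex)
  have "n \<noteq> 0" using n \<tau>0 assms by (cases n) auto
  then obtain i where i: "n = Suc i" by (cases n) auto
  have "\<not> t \<le> \<tau> i" using not_less_Least[of i "\<lambda>n. t \<le> \<tau> n"] i n_def by auto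
  then show thesis using that[of i] n i by auto
qed

lemma pw_linear_grid_nonneg:
  assumes "pw_linear_on_grid \<tau> u" shows "0 \<le> \<tau> i" "\<tau> i < \<tau> (Suc i)"
proof -
  have \<tau>: "strict_mono \<tau>" "\<tau> 0 = 0" using assms unfolding pw_linear_on_grid_def by blast+
  have "\<tau> 0 \<le> \<tau> i" by (rule monoD[OF strict_mono_mono[OF \<tau>(1)]]) simp
  then show "0 \<le> \<tau> i" using \<tau>(2) by simp
  show "\<tau> i < \<tau> (Suc i)" by (rule strict_monoD[OF \<tau>(1)]) simp
qed

lemma reflect_play_on_grid:
  assumes "mono \<gamma>l" "mono \<gamma>r" "\<And>x. \<gamma>r x \<le> \<gamma>l x" and pl: "pw_linear_on_grid \<tau> u"
  shows "play_on_grid \<gamma>l \<gamma>r \<tau> u a (reflect (\<gamma>l \<circ> u) (\<gamma>r \<circ> u) a)"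
  unfolding play_on_grid_def
proof (intro conjI allI ballI)
  show "reflect (\<gamma>l \<circ> u) (\<gamma>r \<circ> u) a 0 = min (\<gamma>l (u 0)) (max (\<gamma>r (u 0)) a)"
    using reflect_zero[of "\<gamma>r \<circ> u" "\<gamma>l \<circ> u"] assms by auto
next
  fix i t assume t: "t \<in> {\<tau> i<..\<tau> (Suc i)}"
  have "\<exists>c b. \<forall>s\<in>{\<tau> i..\<tau> (Suc i)}. u s = c + b * s"
    using pl unfolding pw_linear_on_grid_def by blast
  then obtain c b where u: "\<And>s. s \<in> {\<tau> i..\<tau> (Suc i)} \<Longrightarrow> u s = c + b * s"
    by blast
  have \<tau>: "0 \<le> \<tau> i" using pw_linear_grid_nonneg[OF pl] by auto
  show "reflect (\<gamma>l \<circ> u) (\<gamma>r \<circ> u) a t =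
      min (\<gamma>l (u t)) (max (\<gamma>r (u t)) (reflect (\<gamma>l \<circ> u) (\<gamma>r \<circ> u) a (\<tau> i)))"
  proof (cases "0 \<le> b")
    case True
    have uxy: "u x \<le> u y" if "\<tau> i \<le> x" "x \<le> y" "y \<le> t" for x y
      using that t True u[of x] u[of y] by (auto intro: mult_left_mono)
    have m: "mono_on {\<tau> i..t} (g \<circ> u)" if g: "mono g" for g :: "real \<Rightarrow> real"
      by (rule mono_onI) (simp add: monoD[OF g uxy])
    show ?thesis
      using reflect_incr[OF \<tau> _ _ m[OF assms(1)] m[OF assms(2)], of a] t assms(3) by simp
  next
    case False
    have uxy: "u y \<le> u x" if "\<tau> i \<le> x" "x \<le> y" "y \<le> t" for x y
      using that t False u[of x] u[of y] by (auto intro: mult_left_mono_neg)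
    have m: "antimono_on {\<tau> i..t} (g \<circ> u)" if g: "mono g" for g :: "real \<Rightarrow> real"
      by (rule monotone_onI) (simp add: monoD[OF g uxy])
    show ?thesis
      using reflect_decr[OF \<tau> _ _ m[OF assms(1)] m[OF assms(2)], of a] t assms(3) by simp
  qed
qed

lemma play_on_grid_unique:
  assumes pl: "pw_linear_on_grid \<tau> u"
    and w: "play_on_grid \<gamma>l \<gamma>r \<tau> u a w" and z: "play_on_grid \<gamma>l \<gamma>r \<tau> u a z" and "0 \<le> t"
  shows "w t = z t"
proof -
  have step: "w t = min (\<gamma>l (u t)) (max (\<gamma>r (u t)) (w (\<tau> i)))"
    "z t = min (\<gamma>l (u t)) (max (\<gamma>r (u t)) (z (\<tau> i)))" if "t \<in> {\<tau> i<..\<tau> (Suc i)}" for i t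
    using w z that unfolding play_on_grid_def by blast+
  have nodes: "w (\<tau> i) = z (\<tau> i)" for i
  proof (induction i)
    case 0
    then show ?case using pl w z by (auto simp: pw_linear_on_grid_def play_on_grid_def)
  next
    case (Suc i)
    have "\<tau> (Suc i) \<in> {\<tau> i<..\<tau> (Suc i)}" using pw_linear_grid_nonneg[OF pl] by auto
    then show ?case using Suc step[of "\<tau> (Suc i)" i] by simp
  qed
  show ?thesis
  proof (cases "t = 0")
    case True
    then show ?thesis using w z by (auto simp: play_on_grid_def)
  next
    case False
    then have "0 < t" using assms(4) by simp
    then obtain i where i: "t \<in> {\<tau> i<..\<tau> (Suc i)}" using pw_linear_segment[OF pl] by blast
    show ?thesis using step[OF i] nodes by simp
  qed
qed

lemma uniform_limit_compose_continuous:
  fixes g u :: "real \<Rightarrow> real"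
  assumes g: "continuous_on UNIV g" and u: "continuous_on {0..} u"
    and U: "uniform_limit {0..T} U u sequentially"
  shows "uniform_limit {0..T} (\<lambda>n t. g (U n t)) (\<lambda>t. g (u t)) sequentially"
proof -
  have "compact (u ` {0..T})"
    by (rule compact_continuous_image[OF _ compact_Icc]) (rule continuous_on_subset[OF u], auto)
  then have "bounded (u ` {0..T})" by (rule compact_imp_bounded)
  then obtain B where "\<forall>x\<in>u ` {0..T}. norm x \<le> B" unfolding bounded_iff by blast
  then have B: "\<And>t. t \<in> {0..T} \<Longrightarrow> \<bar>u t\<bar> \<le> B" by (simp only: real_norm_def ball_simps)
  have uc: "uniformly_continuous_on {-B-1..B+1} g"
    by (rule compact_uniformly_continuous[OF _ compact_Icc]) (rule continuous_on_subset[OF g], simp)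
  show ?thesis unfolding uniform_limit_iff
  proof (intro allI impI)
    fix e :: real assume "0 < e"
    then obtain d where d: "0 < d"
      "\<And>x y. x \<in> {-B-1..B+1} \<Longrightarrow> y \<in> {-B-1..B+1} \<Longrightarrow> dist y x < d \<Longrightarrow> dist (g y) (g x) < e"
      using uc unfolding uniformly_continuous_on_def by metis
    have "\<forall>\<^sub>F n in sequentially. \<forall>t\<in>{0..T}. dist (U n t) (u t) < min d 1"
      using uniform_limitD[OF U, of "min d 1"] d(1) by simp
    then show "\<forall>\<^sub>F n in sequentially. \<forall>t\<in>{0..T}. dist (g (U n t)) (g (u t)) < e"
    proof eventually_elim
      case (elim n)
      show ?case
      proof
        fix t assume t: "t \<in> {0..T}"
        have "dist (U n t) (u t) < d" "\<bar>U n t - u t\<bar> < 1" "\<bar>u t\<bar> \<le> B"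
          using elim t B[OF t] by (auto simp: dist_real_def)
        then show "dist (g (U n t)) (g (u t)) < e" by (intro d(2)) auto
      qed
    qed
  qed
qed

lemma reflect_continuous:
  assumes L: "continuous_on {0..} L" and R: "continuous_on {0..} R"
    and RL: "\<And>s. 0 \<le> s \<Longrightarrow> R s \<le> L s"
  shows "continuous_on {0..} (reflect L R a)"
proof -
  show ?thesis unfolding continuous_on_iff
  proof (intro ballI allI impI)
    fix x e :: real assume x: "x \<in> {0..}" and e: "0 < e"
    have e4: "e/4 > 0" using e by auto
    obtain d1 where d1: "d1 > 0" "\<And>y. y \<in> {0..} \<Longrightarrow> dist y x < d1 \<Longrightarrow> dist (L y) (L x) < e/4"
      using L x e4 unfolding continuous_on_iff by metis
    obtain d2 where d2: "d2 > 0" "\<And>y. y \<in> {0..} \<Longrightarrow> dist y x < d2 \<Longrightarrow> dist (R y) (R x) < e/4"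
      using R x e4 unfolding continuous_on_iff by metis
    have key: "\<bar>reflect L R a t - reflect L R a p\<bar> \<le> e/2"
      if "0 \<le> p" "p \<le> t" "dist p x < min d1 d2" "dist t x < min d1 d2" for p t
    proof (rule reflect_time)
      fix s assume s: "s \<in> {p..t}"
      have "dist s x < d1" "dist s x < d2" "s \<in> {0..}" "p \<in> {0..}" "dist p x < d1" "dist p x < d2"
        using s that by (auto simp: dist_real_def)
      then have "\<bar>L s - L x\<bar> < e/4" "\<bar>L p - L x\<bar> < e/4" "\<bar>R s - R x\<bar> < e/4" "\<bar>R p - R x\<bar> < e/4"
        using d1(2)[of s] d1(2)[of p] d2(2)[of s] d2(2)[of p] unfolding dist_real_def by blast+
      then show "\<bar>L s - L p\<bar> \<le> e/2" "\<bar>R s - R p\<bar> \<le> e/2"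
        by linarith+
    qed (use that e RL in auto)
    have near: "dist (reflect L R a y) (reflect L R a x) < e"
      if y: "y \<in> {0..}" "dist y x < min d1 d2" for y
    proof -
      have d: "dist x x < min d1 d2" using d1(1) d2(1) by simp
      have "\<bar>reflect L R a y - reflect L R a x\<bar> \<le> e/2"
      proof (cases "x \<le> y")
        case True
        show ?thesis by (rule key[OF _ True d y(2)]) (use x in simp)
      next
        case False
        have "\<bar>reflect L R a x - reflect L R a y\<bar> \<le> e/2"
          by (rule key[OF _ _ y(2) d]) (use y False in simp_all)
        then show ?thesis by linarith
      qed
      then show ?thesis using e unfolding dist_real_def by linarith
    qed
    show "\<exists>d>0. \<forall>y\<in>{0..}. dist y x < d \<longrightarrow> dist (reflect L R a y) (reflect L R a x) < e"
      by (rule exI[of _ "min d1 d2"]) (use near d1(1) d2(1) in simp)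
  qed
qed

lemma is_generalized_play_reflect:
  assumes cl: "continuous_on UNIV \<gamma>l" and cr: "continuous_on UNIV \<gamma>r"
    and "mono \<gamma>l" "mono \<gamma>r" and rl: "\<And>x. \<gamma>r x \<le> \<gamma>l x"
  shows "is_generalized_play \<gamma>l \<gamma>r (\<lambda>u. reflect (\<gamma>l \<circ> u) (\<gamma>r \<circ> u))"
  unfolding is_generalized_play_def
proof (intro conjI allI impI)
  fix u :: "real \<Rightarrow> real" and w0 assume "continuous_on {0..} u"
  then have "continuous_on {0..} (g \<circ> u)" if "continuous_on UNIV g" for g :: "real \<Rightarrow> real"
    by (rule continuous_on_compose) (rule continuous_on_subset[OF that subset_UNIV])
  then show "continuous_on {0..} (reflect (\<gamma>l \<circ> u) (\<gamma>r \<circ> u) w0)"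
    using cl cr rl by (intro reflect_continuous) simp_all
next
  fix \<tau> u w0 w t assume "pw_linear_on_grid \<tau> u" "play_on_grid \<gamma>l \<gamma>r \<tau> u w0 w" "(0::real) \<le> t"
  then show "reflect (\<gamma>l \<circ> u) (\<gamma>r \<circ> u) w0 t = w t"
    by (intro play_on_grid_unique[OF _ reflect_play_on_grid[OF assms(3-5)]])
next
  fix U :: "nat \<Rightarrow> real \<Rightarrow> real" and u and a :: "nat \<Rightarrow> real" and w0 T :: real
  assume U: "\<forall>n. continuous_on {0..} (U n)" and u: "continuous_on {0..} u"
    and lim: "\<forall>T. uniform_limit {0..T} U u sequentially" and a: "a \<longlonglongrightarrow> w0"
  show "uniform_limit {0..T} (\<lambda>n. reflect (\<gamma>l \<circ> U n) (\<gamma>r \<circ> U n) (a n))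
          (reflect (\<gamma>l \<circ> u) (\<gamma>r \<circ> u) w0) sequentially"
    unfolding uniform_limit_iff
  proof (intro allI impI)
    fix e :: real assume e: "0 < e"
    have "\<forall>\<^sub>F n in sequentially. \<forall>t\<in>{0..T}. dist (\<gamma>l (U n t)) (\<gamma>l (u t)) < e/2"
      using uniform_limitD[OF uniform_limit_compose_continuous[OF cl u lim[rule_format]], of "e/2"] e
      by simp
    moreover have "\<forall>\<^sub>F n in sequentially. \<forall>t\<in>{0..T}. dist (\<gamma>r (U n t)) (\<gamma>r (u t)) < e/2"
      using uniform_limitD[OF uniform_limit_compose_continuous[OF cr u lim[rule_format]], of "e/2"] e
      by simp
    moreover have "\<forall>\<^sub>F n in sequentially. dist (a n) w0 < e/2"
      using tendstoD[OF a, of "e/2"] e by auto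
    ultimately show "\<forall>\<^sub>F n in sequentially. \<forall>t\<in>{0..T}.
        dist (reflect (\<gamma>l \<circ> U n) (\<gamma>r \<circ> U n) (a n) t) (reflect (\<gamma>l \<circ> u) (\<gamma>r \<circ> u) w0 t) < e"
    proof eventually_elim
      case (elim n)
      show ?case
      proof
        fix t assume t: "t \<in> {0..T}"
        have l: "\<bar>\<gamma>l (U n s) - \<gamma>l (u s)\<bar> < e/2" "\<bar>\<gamma>r (U n s) - \<gamma>r (u s)\<bar> < e/2" if "s \<in> {0..t}" for s
          using elim that t by (auto simp: dist_real_def)
        have l': "\<gamma>l (U n s) \<le> \<gamma>l (u s) + e/2" "\<gamma>l (u s) \<le> \<gamma>l (U n s) + e/2"
          "\<gamma>r (U n s) \<le> \<gamma>r (u s) + e/2" "\<gamma>r (u s) \<le> \<gamma>r (U n s) + e/2" if "s \<in> {0..t}" for s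
          using l[OF that] by linarith+
        have a': "a n \<le> w0 + e/2" "w0 \<le> a n + e/2"
          using elim(3) unfolding dist_real_def by linarith+
        have "reflect (\<gamma>l \<circ> U n) (\<gamma>r \<circ> U n) (a n) t \<le> reflect (\<gamma>l \<circ> u) (\<gamma>r \<circ> u) w0 t + e/2"
          by (rule reflect_close) (use t l' a' rl in auto)
        moreover have "reflect (\<gamma>l \<circ> u) (\<gamma>r \<circ> u) w0 t \<le> reflect (\<gamma>l \<circ> U n) (\<gamma>r \<circ> U n) (a n) t + e/2"
          by (rule reflect_close) (use t l' a' rl in auto)
        ultimately have "\<bar>reflect (\<gamma>l \<circ> U n) (\<gamma>r \<circ> U n) (a n) t - reflect (\<gamma>l \<circ> u) (\<gamma>r \<circ> u) w0 t\<bar> \<le> e/2"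
          by linarith
        then show "dist (reflect (\<gamma>l \<circ> U n) (\<gamma>r \<circ> U n) (a n) t) (reflect (\<gamma>l \<circ> u) (\<gamma>r \<circ> u) w0 t) < e"
          using e by (auto simp: dist_real_def)
      qed
    qed
  qed
qed

lemma is_generalized_play_generalized_play:
  assumes "continuous_on UNIV \<gamma>l" "continuous_on UNIV \<gamma>r" "mono \<gamma>l" "mono \<gamma>r" "\<And>x. \<gamma>r x \<le> \<gamma>l x"
  shows "is_generalized_play \<gamma>l \<gamma>r (generalized_play \<gamma>l \<gamma>r)"
  unfolding generalized_play_def
  by (rule someI[of "is_generalized_play \<gamma>l \<gamma>r"]) (rule is_generalized_play_reflect[OF assms])

subsection \<open>Uniqueness of the generalized play operator\<close>

lemma pw_linear_continuous:
  assumes pl: "pw_linear_on_grid \<tau> u"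
  shows "continuous_on {0..} u"
proof -
  note \<tau> = pw_linear_grid_nonneg[OF pl]
  have *: "continuous_on {0..\<tau> i} u" for i
  proof (induction i)
    case 0
    have "\<tau> 0 = 0" using pl unfolding pw_linear_on_grid_def by blast
    then show ?case by simp
  next
    case (Suc i)
    have "\<exists>a b. \<forall>t\<in>{\<tau> i..\<tau> (Suc i)}. u t = a + b * t"
      using pl unfolding pw_linear_on_grid_def by blast
    then obtain a b where ab: "\<And>t. t \<in> {\<tau> i..\<tau> (Suc i)} \<Longrightarrow> u t = a + b * t" by blast
    have "continuous_on {\<tau> i..\<tau> (Suc i)} (\<lambda>t. a + b * t)" by (intro continuous_intros)
    then have "continuous_on {\<tau> i..\<tau> (Suc i)} u"
      using continuous_on_cong[OF HOL.refl ab, of "{\<tau> i..\<tau> (Suc i)}"] by simp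
    then have "continuous_on ({0..\<tau> i} \<union> {\<tau> i..\<tau> (Suc i)}) u"
      using Suc by (intro continuous_on_closed_Un) auto
    moreover have "{0..\<tau> i} \<union> {\<tau> i..\<tau> (Suc i)} = {0..\<tau> (Suc i)}"
      using \<tau>(1)[of i] \<tau>(2)[of i] by auto
    ultimately show ?case by simp
  qed
  show ?thesis unfolding continuous_on_eq_continuous_within
  proof
    fix x :: real assume x: "x \<in> {0..}"
    obtain i where i: "x + 1 \<in> {\<tau> i<..\<tau> (Suc i)}"
      using pw_linear_segment[OF pl, of "x + 1"] x by auto
    have "continuous (at x within {0..\<tau> (Suc i)}) u"
      using * x i by (auto simp: continuous_on_eq_continuous_within)
    moreover have "at x within {0..\<tau> (Suc i)} = at x within {0..}"
      by (rule at_within_nhd[of _ "{..<\<tau> (Suc i)}"]) (use x i in auto)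
    ultimately show "continuous (at x within {0..}) u" by simp
  qed
qed

definition interp :: "nat \<Rightarrow> (real \<Rightarrow> real) \<Rightarrow> real \<Rightarrow> real" where
  "interp n u t = (let m = real (Suc n); k = real_of_int \<lfloor>t * m\<rfloor> in
     u (k / m) + (t * m - k) * (u ((k + 1) / m) - u (k / m)))"

lemma interp_segment:
  assumes "real i / real (Suc n) \<le> t" "t \<le> real (Suc i) / real (Suc n)"
  shows "interp n u t = u (real i / real (Suc n)) +
    (t * real (Suc n) - real i) * (u (real (Suc i) / real (Suc n)) - u (real i / real (Suc n)))"
proof -
  define m where "m = real (Suc n)"
  have m: "m > 0" unfolding m_def by simp
  have i: "real i \<le> t * m" "t * m \<le> real i + 1"
    using assms m unfolding m_def[symmetric] by (auto simp: field_simps)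
  show ?thesis
  proof (cases "t * m < real i + 1")
    case True
    then have "\<lfloor>t * m\<rfloor> = int i" using i by (simp add: floor_eq_iff)
    then have "interp n u t = u (real i / m) + (t * m - real i) * (u ((real i + 1) / m) - u (real i / m))"
      unfolding interp_def Let_def m_def[symmetric] by simp
    moreover have "real (Suc i) = real i + 1" by simp
    ultimately show ?thesis unfolding m_def[symmetric] by (simp only:)
  next
    case False
    then have e: "t * m = real i + 1" using i by simp
    then have "real_of_int \<lfloor>t * m\<rfloor> = real i + 1" by simp
    then have "interp n u t = u ((real i + 1) / m)"
      unfolding interp_def Let_def m_def[symmetric] using e by simp
    then show ?thesis unfolding m_def[symmetric] e by (simp add: add.commute)
  qed
qed

lemma pw_linear_interp: "pw_linear_on_grid (\<lambda>i. real i / real (Suc n)) (interp n u)"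
  unfolding pw_linear_on_grid_def
proof (intro conjI allI)
  show "strict_mono (\<lambda>i. real i / real (Suc n))" by (intro strict_monoI divide_strict_right_mono) auto
  have "filterlim (\<lambda>i. real i * (1 / real (Suc n))) at_top sequentially"
    by (rule filterlim_at_top_mult_tendsto_pos[where f = "\<lambda>_. 1 / real (Suc n)" and c = "1 / real (Suc n)"])
       (auto intro: filterlim_real_sequentially)
  then show "filterlim (\<lambda>i. real i / real (Suc n)) at_top sequentially" by simp
  fix i
  define p q where "p = u (real i / real (Suc n))"
    and "q = u (real (Suc i) / real (Suc n)) - u (real i / real (Suc n))"
  show "\<exists>a b. \<forall>t\<in>{real i / real (Suc n)..real (Suc i) / real (Suc n)}. interp n u t = a + b * t"
  proof (intro exI ballI)
    fix t assume "t \<in> {real i / real (Suc n)..real (Suc i) / real (Suc n)}"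
    then have "interp n u t = p + (t * real (Suc n) - real i) * q"
      unfolding p_def q_def by (intro interp_segment) auto
    then show "interp n u t = (p - real i * q) + (real (Suc n) * q) * t"
      by (simp only: algebra_simps)
  qed
qed simp

lemma interp_uniform_limit:
  assumes u: "continuous_on {0..} u"
  shows "uniform_limit {0..T} (\<lambda>n. interp n u) u sequentially"
  unfolding uniform_limit_iff
proof (intro allI impI)
  fix e :: real assume e: "0 < e"
  have "uniformly_continuous_on {0..T+1} u"
    by (rule compact_uniformly_continuous[OF _ compact_Icc]) (rule continuous_on_subset[OF u], auto)
  then obtain d where d: "d > 0"
    "\<And>x y. x \<in> {0..T+1} \<Longrightarrow> y \<in> {0..T+1} \<Longrightarrow> dist y x < d \<Longrightarrow> dist (u y) (u x) < e"
    using e unfolding uniformly_continuous_on_def by metis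
  have "(\<lambda>n. inverse (real (Suc n))) \<longlonglongrightarrow> 0" by (rule LIMSEQ_inverse_real_of_nat)
  from order_tendstoD(2)[OF this, of "min d 1"]
  have "\<forall>\<^sub>F n in sequentially. inverse (real (Suc n)) < min d 1" using d(1) by simp
  then show "\<forall>\<^sub>F n in sequentially. \<forall>t\<in>{0..T}. dist (interp n u t) (u t) < e"
  proof eventually_elim
    case (elim n)
    define m where "m = real (Suc n)"
    have m: "m > 0" "1 / m < d" "1 / m < 1"
      using elim unfolding m_def by (auto simp: inverse_eq_divide)
    show ?case
    proof
      fix t assume t: "t \<in> {0..T}"
      define k where "k = real_of_int \<lfloor>t * m\<rfloor>"
      have k: "0 \<le> k" "k \<le> t * m" "t * m < k + 1"
        using t m unfolding k_def by (auto simp: floor_less_iff)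
      have k1: "0 \<le> k / m" "k / m \<le> t" "t \<le> (k + 1) / m" "(k + 1) / m = k / m + 1 / m"
        using k m by (auto simp: field_simps)
      have mem: "k / m \<in> {0..T+1}" "(k + 1) / m \<in> {0..T+1}" "t \<in> {0..T+1}"
        using k1 m(3) t unfolding atLeastAtMost_iff by linarith+
      have "dist (k / m) t < d" "dist ((k + 1) / m) t < d"
        using k1 m(2) unfolding dist_real_def by linarith+
      then have A: "dist (u (k / m)) (u t) < e" and B: "dist (u ((k + 1) / m)) (u t) < e"
        using d(2)[OF mem(3) mem(1)] d(2)[OF mem(3) mem(2)] by blast+
      define l where "l = t * m - k"
      have l: "0 \<le> l" "l \<le> 1" using k unfolding l_def by auto
      have "interp n u t = (1 - l) *\<^sub>R u (k / m) + l *\<^sub>R u ((k + 1) / m)"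
        unfolding interp_def Let_def m_def[symmetric] k_def[symmetric] l_def[symmetric]
        by (simp add: algebra_simps)
      moreover have "\<dots> \<in> ball (u t) e"
        by (rule convexD[OF convex_ball]) (use A B l in \<open>auto simp: dist_commute\<close>)
      ultimately show "dist (interp n u t) (u t) < e" by (simp add: dist_commute)
    qed
  qed
qed

lemma is_generalized_play_unique:
  assumes "continuous_on UNIV \<gamma>l" "continuous_on UNIV \<gamma>r" "mono \<gamma>l" "mono \<gamma>r" "\<And>x. \<gamma>r x \<le> \<gamma>l x"
    and H: "is_generalized_play \<gamma>l \<gamma>r H" and u: "continuous_on {0..} u" and t: "0 \<le> t"
  shows "H u w0 t = generalized_play \<gamma>l \<gamma>r u w0 t"
proof -
  have lim: "(\<lambda>n. G (interp n u) w0 t) \<longlonglongrightarrow> G u w0 t" if G: "is_generalized_play \<gamma>l \<gamma>r G" for G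
  proof -
    have "uniform_limit {0..t} (\<lambda>n. G (interp n u) w0) (G u w0) sequentially"
      by (rule G[unfolded is_generalized_play_def, THEN conjunct2, THEN conjunct2, rule_format])
        (auto intro: u interp_uniform_limit pw_linear_continuous pw_linear_interp)
    then show ?thesis by (rule tendsto_uniform_limitI) (use t in auto)
  qed
  have eq: "G (interp n u) w0 t = reflect (\<gamma>l \<circ> interp n u) (\<gamma>r \<circ> interp n u) w0 t"
    if G: "is_generalized_play \<gamma>l \<gamma>r G" for G n
    by (rule G[unfolded is_generalized_play_def, THEN conjunct2, THEN conjunct1, rule_format])
      (rule pw_linear_interp reflect_play_on_grid[OF assms(3-5) pw_linear_interp] t)+
  note gen = is_generalized_play_generalized_play[OF assms(1-5)]
  show ?thesis
    by (rule LIMSEQ_unique[OF lim[OF H]]) (use lim[OF gen] in \<open>simp only: eq[OF gen] eq[OF H]\<close>)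
qed

end

theory Submission
  imports Defs
begin

text \<open>
  Let \<open>w\<close> be the play output along the solution \<open>u\<close>, so that \<open>u' = K (R - w)\<close>, and suppose
  \<open>w0 > R\<close>. As long as \<open>w > R\<close>, the input \<open>u\<close> decreases, and along a decreasing input the play
  reduces to \<open>w t = min w0 (\<gamma>l (u t))\<close>. Hence \<open>u\<close> solves the scalar autonomous equation
  \<open>u' = K (R - min w0 (\<gamma>l u))\<close>. If \<open>w\<close> reached \<open>R\<close> at a time \<open>T\<close>, then a state \<open>u T\<close> with
  \<open>\<gamma>l (u T) \<le> R\<close> would be reached in finite time from \<open>u0\<close>, where \<open>\<gamma>l u0 > R\<close>; this is impossible
  because \<open>\<gamma>l\<close> is Lipschitz.
  So \<open>w > R\<close> forever (\<open>descendingI\<close>).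

  Consequently \<open>u\<close> decreases for all times and stays above \<open>u1\<close>, and it cannot stay above
  \<open>u1 + e\<close>, because there its slope is bounded away from zero; so \<open>u\<close> tends to \<open>u1\<close>
  (\<open>descending_tendsto\<close>). For stability, wait until \<open>u\<close> is \<open>\<epsilon>/2\<close>-close to \<open>u1\<close>, say at time
  \<open>T\<close>. Up to time \<open>T\<close> the right-hand side, being non-increasing in the state, keeps a solution
  with nearby data \<open>\<epsilon>/2\<close>-close (\<open>descending_close\<close>); afterwards both solutions lie
  in \<open>(u1, u1 + \<epsilon>)\<close> (\<open>descending_stable\<close>).

  The case \<open>w0 < R\<close> is the mirror image under \<open>u \<mapsto> -u\<close>, \<open>w \<mapsto> -w\<close>, \<open>R \<mapsto> -R\<close>, with \<open>\<gamma>r\<close>, \<open>u2\<close> in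
  place of \<open>\<gamma>l\<close>, \<open>u1\<close>; the analysis is therefore formulated for a single boundary curve \<open>g\<close>,
  which is \<open>\<gamma>l\<close> or \<open>\<lambda>x. - \<gamma>r (- x)\<close>.
\<close>

section \<open>Slope estimates on the half-line\<close>

lemma increment_le_of_slope_le:
  fixes d D :: "real \<Rightarrow> real"
  assumes der: "\<And>s. 0 \<le> s \<Longrightarrow> (d has_real_derivative D s) (at s within {0..})"
    and slope: "\<And>s. p < s \<Longrightarrow> s < t \<Longrightarrow> D s \<le> c"
    and "0 \<le> p" "p \<le> t"
  shows "d t - d p \<le> c * (t - p)"
proof -
  have "d p - c * p \<ge> d t - c * t"
  proof (rule DERIV_nonpos_imp_decreasing_open[OF \<open>p \<le> t\<close>])
    fix s assume s: "p < s" "s < t"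
    have "at s within {0..} = at s"
      by (rule at_within_interior) (use s assms(3) in simp)
    then have "(d has_real_derivative D s) (at s)"
      using der[of s] s assms(3) by simp
    then have "((\<lambda>x. d x - c * x) has_real_derivative D s - c) (at s)"
      by (auto intro!: derivative_eq_intros)
    then show "\<exists>y. ((\<lambda>x. d x - c * x) has_real_derivative y) (at s) \<and> y \<le> 0"
      using slope[OF s] by auto
  next
    have "continuous_on {0..} d"
      by (rule DERIV_continuous_on) (use der in auto)
    then have "continuous_on {p..t} d"
      by (rule continuous_on_subset) (use assms(3) in auto)
    then show "continuous_on {p..t} (\<lambda>x. d x - c * x)"
      by (intro continuous_intros)
  qed
  then show ?thesis by (simp add: algebra_simps)
qed

text \<open>
  Only the slope at points where the function is positive matters for an upper bound.
\<close>

lemma le_linear_of_slope_le_where_pos: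
  fixes d D :: "real \<Rightarrow> real"
  assumes der: "\<And>s. 0 \<le> s \<Longrightarrow> (d has_real_derivative D s) (at s within {0..})"
    and slope: "\<And>s. 0 \<le> s \<Longrightarrow> 0 < d s \<Longrightarrow> D s \<le> c"
    and "0 \<le> c" "0 \<le> t"
  shows "d t \<le> max (d 0) 0 + c * t"
proof -
  define m where "m = max (d 0) 0"
  define S where "S = {s \<in> {0..t}. d s \<le> m}"
  have "continuous_on {0..} d"
    by (rule DERIV_continuous_on) (use der in auto)
  then have "continuous_on {0..t} d"
    by (rule continuous_on_subset) auto
  then have "closed S"
    unfolding S_def by (intro continuous_on_closed_Collect_le) auto
  moreover have "bounded S"
    by (rule bounded_subset[of "{0..t}"]) (auto simp: S_def)
  ultimately have "compact S" by (simp add: compact_eq_bounded_closed)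
  moreover have "0 \<in> S" using \<open>0 \<le> t\<close> by (simp add: S_def m_def)
  ultimately obtain p where p: "p \<in> S" "\<And>s. s \<in> S \<Longrightarrow> s \<le> p"
    using compact_attains_sup[of S] by blast
  have "d t - d p \<le> c * (t - p)"
  proof (rule increment_le_of_slope_le[OF der])
    fix s assume s: "p < s" "s < t"
    have "s \<notin> S" using p(2)[of s] s by auto
    then have "0 < d s" using s p(1) by (auto simp: S_def m_def)
    then show "D s \<le> c" using slope[of s] s p(1) by (auto simp: S_def)
  qed (use p(1) in \<open>auto simp: S_def\<close>)
  moreover have "c * (t - p) \<le> c * t"
    using p(1) \<open>0 \<le> c\<close> by (intro mult_left_mono) (auto simp: S_def)
  ultimately show ?thesis using p(1) by (simp add: S_def m_def)
qed

section \<open>Descending solutions\<close>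

text \<open>
  \<open>descending g K R z v\<close>: the state \<open>v\<close> solves \<open>v' = K (R - min z (g v))\<close> on the half-line, and the
  output \<open>min z (g v)\<close> stays strictly above \<open>R\<close>. If \<open>z \<le> g (v 0)\<close>, then \<open>z\<close> is the
  initial output, which is kept as long as \<open>z \<le> g v\<close>; below that the output follows \<open>g\<close>.
\<close>

definition descending ::
  "(real \<Rightarrow> real) \<Rightarrow> real \<Rightarrow> real \<Rightarrow> real \<Rightarrow> (real \<Rightarrow> real) \<Rightarrow> bool" where
  "descending g K R z v \<longleftrightarrow>
     (\<forall>t\<ge>0. R < min z (g (v t)) \<and>
        (v has_real_derivative K * (R - min z (g (v t)))) (at t within {0..}))"

lemma descending_output_gt: "R < min z (g (v t))" if "descending g K R z v" "0 \<le> t"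
  using that by (simp add: descending_def)

lemma descending_has_derivative:
  "(v has_real_derivative K * (R - min z (g (v t)))) (at t within {0..})"
  if "descending g K R z v" "0 \<le> t"
  using that by (simp add: descending_def)

text \<open>
  An output \<open>w\<close> that starts above \<open>R\<close> and obeys the play rule as long as the state decreases never
  comes down to \<open>R\<close>.
\<close>

lemma descendingI:
  fixes g v w :: "real \<Rightarrow> real"
  assumes g: "mono g" and lip: "C-lipschitz_on UNIV g" and K: "0 < K"
    and w: "continuous_on {0..} w"
    and der: "\<And>t. 0 \<le> t \<Longrightarrow> (v has_real_derivative K * (R - w t)) (at t within {0..})"
    and rule: "\<And>t. 0 \<le> t \<Longrightarrow> antimono_on {0..t} v \<Longrightarrow> w t = min z (g (v t))"
    and z: "R < z" "z \<le> g (v 0)"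
  shows "descending g K R z v"
proof -
  have anti: "antimono_on {0..t} v" if "\<And>s. 0 \<le> s \<Longrightarrow> s < t \<Longrightarrow> R < w s" for t
  proof (rule monotone_onI)
    fix x y assume xy: "x \<in> {0..t}" "y \<in> {0..t}" "x \<le> y"
    have "v y - v x \<le> 0 * (y - x)"
    proof (rule increment_le_of_slope_le[OF der])
      fix s assume "x < s" "s < y"
      then have "R < w s" using that[of s] xy by auto
      then show "K * (R - w s) \<le> 0" using K by (intro mult_nonneg_nonpos) auto
    qed (use xy in auto)
    then show "v y \<le> v x" by simp
  qed
  have pos: "R < w t" if t: "0 \<le> t" for t
  proof (rule ccontr)
    assume neg: "\<not> R < w t"
    define S where "S = {s \<in> {0..t}. w s \<le> R}"
    have "continuous_on {0..t} w"
      by (rule continuous_on_subset[OF w]) auto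
    then have "closed S"
      unfolding S_def by (intro continuous_on_closed_Collect_le) auto
    moreover have "bounded S"
      by (rule bounded_subset[of "{0..t}"]) (auto simp: S_def)
    ultimately have "compact S" by (simp add: compact_eq_bounded_closed)
    moreover have "t \<in> S" using t neg by (simp add: S_def)
    ultimately obtain T where T: "T \<in> S" "\<And>s. s \<in> S \<Longrightarrow> T \<le> s"
      using compact_attains_inf[of S] by blast
    have T0: "0 \<le> T" "w T \<le> R" using T(1) by (auto simp: S_def)
    have before: "R < w s" if "0 \<le> s" "s < T" for s
      using T(2)[of s] T(1) that by (intro not_le_imp_less) (auto simp: S_def)
    have antiT: "antimono_on {0..T} v" using anti before by blast
    have w_eq: "w s = min z (g (v s))" if "0 \<le> s" "s \<le> T" for s
      by (rule rule) (use that antiT in \<open>auto intro: monotone_on_subset\<close>)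
    have gT: "g (v T) \<le> R" using w_eq[of T] T0 z(1) by auto
    \<comment> \<open>The distance to \<open>v T\<close> decays no faster than exponentially, hence cannot vanish at \<open>T\<close>.\<close>
    define h where "h s = - ((v s - v T) * exp (K * C * s))" for s
    have "h T - h 0 \<le> 0 * (T - 0)"
    proof (rule increment_le_of_slope_le)
      fix s :: real assume "0 \<le> s"
      show "(h has_real_derivative
          - (exp (K * C * s) * K * (R - w s + C * (v s - v T)))) (at s within {0..})"
        unfolding h_def
        by (rule derivative_eq_intros der \<open>0 \<le> s\<close> HOL.refl)+ (simp add: algebra_simps)
    next
      fix s assume s: "0 < s" "s < T"
      have "v T \<le> v s" using monotone_onD[OF antiT, of s T] s by auto
      then have "g (v s) - g (v T) \<le> C * (v s - v T)"
        using lipschitz_onD[OF lip, of "v s" "v T"] by (simp add: dist_real_def)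
      then have "0 \<le> R - w s + C * (v s - v T)" using w_eq[of s] s gT by auto
      then show "- (exp (K * C * s) * K * (R - w s + C * (v s - v T))) \<le> 0"
        using K by simp
    qed (use T0 in auto)
    then have "v 0 \<le> v T" by (simp add: h_def)
    then have "g (v 0) \<le> R" using monoD[OF g] gT by fastforce
    then show False using z by simp
  qed
  have "w t = min z (g (v t))" if "0 \<le> t" for t
    using rule anti pos that by auto
  then show ?thesis
    unfolding descending_def using pos der by simp
qed

lemma descending_antimono:
  assumes "descending g K R z v" "0 < K" "0 \<le> s" "s \<le> t"
  shows "v t \<le> v s"
proof -
  have "v t - v s \<le> 0 * (t - s)"
  proof (rule increment_le_of_slope_le[OF descending_has_derivative[OF assms(1)]])
    fix x assume "s < x" "x < t"
    then show "K * (R - min z (g (v x))) \<le> 0"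
      using descending_output_gt[OF assms(1), of x] assms by (intro mult_nonneg_nonpos) auto
  qed (use assms in auto)
  then show ?thesis by simp
qed

lemma descending_gt:
  assumes "descending g K R z v" "mono g" "g a = R" "0 \<le> t"
  shows "a < v t"
  using descending_output_gt[OF assms(1,4)] monoD[OF assms(2), of "v t" a] assms(3)
  by (cases "a < v t") auto

lemma descending_eventually_lt:
  assumes v: "descending g K R z v" and g: "mono g" and K: "0 < K"
    and a: "g a = R" "\<And>x. g x = R \<Longrightarrow> x \<le> a" and e: "0 < e"
  obtains T where "0 \<le> T" "v T < a + e"
proof -
  define c where "c = min z (g (a + e)) - R"
  have "R \<le> g (a + e)" using monoD[OF g, of a "a + e"] a(1) e by simp
  moreover have "g (a + e) \<noteq> R" using a(2)[of "a + e"] e by auto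
  ultimately have c: "0 < c" using descending_output_gt[OF v, of 0] by (auto simp: c_def)
  \<comment> \<open>Above \<open>a + e\<close> the slope is at most \<open>- K c\<close>; at this rate \<open>a\<close> would be reached at time \<open>T\<close>.\<close>
  define T where "T = (v 0 - a) / (K * c)"
  have T: "0 \<le> T" using descending_gt[OF v g a(1), of 0] K c by (simp add: T_def)
  have "\<exists>t\<ge>0. v t < a + e"
  proof (rule ccontr)
    assume "\<not> ?thesis"
    then have above: "a + e \<le> v t" if "0 \<le> t" for t using that by force
    have "v T - v 0 \<le> - (K * c) * (T - 0)"
    proof (rule increment_le_of_slope_le[OF descending_has_derivative[OF v]])
      fix s assume "0 < s" "s < T"
      then have "g (a + e) \<le> g (v s)" using above[of s] by (intro monoD[OF g]) auto
      then have "R - min z (g (v s)) \<le> - c" by (auto simp: c_def)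
      then have "K * (R - min z (g (v s))) \<le> K * - c" using K by (intro mult_left_mono) auto
      then show "K * (R - min z (g (v s))) \<le> - (K * c)" by simp
    qed (use T in auto)
    then have "v T \<le> a" using K c by (simp add: T_def)
    then show False using above[OF T] e by simp
  qed
  then show thesis using that by blast
qed

lemma descending_tendsto:
  assumes v: "descending g K R z v" and g: "mono g" and K: "0 < K"
    and a: "g a = R" "\<And>x. g x = R \<Longrightarrow> x \<le> a"
  shows "(v \<longlongrightarrow> a) at_top"
proof (rule tendstoI)
  fix e :: real assume "0 < e"
  then obtain T where T: "0 \<le> T" "v T < a + e"
    using descending_eventually_lt[OF v g K a] by blast
  show "\<forall>\<^sub>F t in at_top. dist (v t) a < e"
    using eventually_ge_at_top[of T]
  proof eventually_elim
    case (elim t)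
    have "v t \<le> v T" by (rule descending_antimono[OF v K T(1) elim])
    moreover have "a < v t" by (rule descending_gt[OF v g a(1)]) (use T(1) elim in simp)
    ultimately show ?case using T(2) by (simp add: dist_real_def)
  qed
qed

lemma descending_diff_le:
  assumes v: "descending g K R z v" and v': "descending g K R z' v'"
    and g: "mono g" and K: "0 < K" and t: "0 \<le> t"
  shows "v t - v' t \<le> \<bar>v 0 - v' 0\<bar> + K * \<bar>z - z'\<bar> * t"
proof -
  have "v t - v' t \<le> max (v 0 - v' 0) 0 + K * \<bar>z - z'\<bar> * t"
  proof (rule le_linear_of_slope_le_where_pos)
    fix s :: real assume s: "0 \<le> s"
    show "((\<lambda>s. v s - v' s) has_real_derivative
        K * (R - min z (g (v s))) - K * (R - min z' (g (v' s)))) (at s within {0..})"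
      by (intro DERIV_diff descending_has_derivative v v' s)
    assume "0 < v s - v' s"
    then have "g (v' s) \<le> g (v s)" by (intro monoD[OF g]) simp
    then have "min z' (g (v' s)) - min z (g (v s)) \<le> \<bar>z - z'\<bar>" by linarith
    then have "K * (min z' (g (v' s)) - min z (g (v s))) \<le> K * \<bar>z - z'\<bar>"
      using K by (intro mult_left_mono) auto
    then show "K * (R - min z (g (v s))) - K * (R - min z' (g (v' s))) \<le> K * \<bar>z - z'\<bar>"
      by (simp add: algebra_simps)
  qed (use K t in auto)
  then show ?thesis by linarith
qed

lemma descending_close:
  assumes "descending g K R z v" "descending g K R z' v'" "mono g" "0 < K" "0 \<le> t"
  shows "\<bar>v t - v' t\<bar> \<le> \<bar>v 0 - v' 0\<bar> + K * \<bar>z - z'\<bar> * t"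
  using descending_diff_le[OF assms] descending_diff_le[OF assms(2,1,3-5)]
  by (simp add: abs_minus_commute abs_le_iff)

lemma descending_stable:
  assumes v: "descending g K R z v" and g: "mono g" and K: "0 < K"
    and a: "g a = R" "\<And>x. g x = R \<Longrightarrow> x \<le> a" and e: "0 < e"
  obtains \<delta> where "0 < \<delta>"
    "\<And>z' v' t. descending g K R z' v' \<Longrightarrow> \<bar>v' 0 - v 0\<bar> + \<bar>z' - z\<bar> < \<delta> \<Longrightarrow> 0 \<le> t \<Longrightarrow>
      \<bar>v' t - v t\<bar> < e"
proof -
  obtain T where T: "0 \<le> T" "v T < a + e / 2"
    using descending_eventually_lt[OF v g K a, of "e / 2"] e by auto
  define \<delta> where "\<delta> = e / 2 / (1 + K * T)"
  have KT: "0 \<le> K * T" using K T(1) by simp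
  have \<delta>: "0 < \<delta>" using e KT by (simp add: \<delta>_def)
  have "\<bar>v' t - v t\<bar> < e"
    if v': "descending g K R z' v'" and d: "\<bar>v' 0 - v 0\<bar> + \<bar>z' - z\<bar> < \<delta>" and t: "0 \<le> t" for z' v' t
  proof -
    have early: "\<bar>v' s - v s\<bar> < e / 2" if s: "0 \<le> s" "s \<le> T" for s
    proof -
      have "\<bar>v' s - v s\<bar> \<le> \<bar>v' 0 - v 0\<bar> + K * \<bar>z' - z\<bar> * s"
        by (rule descending_close[OF v' v g K s(1)])
      also have "\<dots> \<le> (1 + K * T) * (\<bar>v' 0 - v 0\<bar> + \<bar>z' - z\<bar>)"
      proof -
        have "(K * \<bar>z' - z\<bar>) * s \<le> (K * \<bar>z' - z\<bar>) * T" using K s by (intro mult_left_mono) auto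
        moreover have "0 \<le> K * T * \<bar>v' 0 - v 0\<bar>" using KT by simp
        ultimately show ?thesis by (simp add: algebra_simps)
      qed
      also have "\<dots> < (1 + K * T) * \<delta>" using d KT by (intro mult_strict_left_mono) auto
      also have "\<dots> = e / 2" using KT nonzero_mult_div_cancel_left[of "1 + K * T" "e / 2"] unfolding \<delta>_def by simp
      finally show ?thesis .
    qed
    show ?thesis
    proof (cases "t \<le> T")
      case True
      then show ?thesis using early[of t] t e by simp
    next
      case False
      then have "v t \<le> v T" "v' t \<le> v' T"
        using descending_antimono[OF v K T(1)] descending_antimono[OF v' K T(1)] by auto
      moreover have "v' T < a + e" using early[of T] T by linarith
      moreover have "a < v t" "a < v' t"
        using descending_gt[OF v g a(1) t] descending_gt[OF v' g a(1) t] by auto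
      ultimately show ?thesis using T(2) e by linarith
    qed
  qed
  then show thesis using that \<delta> by blast
qed

section \<open>Solutions of the Cauchy problem\<close>

lemma generalized_play_eq_reflect:
  assumes "continuous_on UNIV \<gamma>l" "continuous_on UNIV \<gamma>r" "mono \<gamma>l" "mono \<gamma>r" "\<And>x. \<gamma>r x \<le> \<gamma>l x"
    and "continuous_on {0..} u" "0 \<le> t"
  shows "generalized_play \<gamma>l \<gamma>r u w0 t = reflect (\<gamma>l \<circ> u) (\<gamma>r \<circ> u) w0 t"
  by (rule is_generalized_play_unique[OF assms(1-5) is_generalized_play_reflect[OF assms(1-5)]
        assms(6,7), symmetric])

text \<open>
  Along a monotone input only one boundary curve is active, since the admissible initial output
  stays on the correct side of the other one.
\<close>

lemma generalized_play_antimono: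
  assumes "continuous_on UNIV \<gamma>l" "continuous_on UNIV \<gamma>r" "mono \<gamma>l" "mono \<gamma>r" "\<And>x. \<gamma>r x \<le> \<gamma>l x"
    and u: "continuous_on {0..} u" and t: "0 \<le> t" and anti: "antimono_on {0..t} u"
    and w0: "\<gamma>r (u 0) \<le> w0" "w0 \<le> \<gamma>l (u 0)"
  shows "generalized_play \<gamma>l \<gamma>r u w0 t = min w0 (\<gamma>l (u t))"
proof -
  have comp: "antimono_on {0..t} (g \<circ> u)" if "mono g" for g :: "real \<Rightarrow> real"
    by (rule monotone_onI) (simp add: monoD[OF that] monotone_onD[OF anti])
  have "reflect (\<gamma>l \<circ> u) (\<gamma>r \<circ> u) w0 t =
      min (\<gamma>l (u t)) (max (\<gamma>r (u t)) (reflect (\<gamma>l \<circ> u) (\<gamma>r \<circ> u) w0 0))"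
    using reflect_decr[of 0 t "\<gamma>r \<circ> u" "\<gamma>l \<circ> u" w0] t comp assms(3-5) by simp
  moreover have "reflect (\<gamma>l \<circ> u) (\<gamma>r \<circ> u) w0 0 = w0"
    using reflect_zero[of "\<gamma>r \<circ> u" "\<gamma>l \<circ> u" w0] assms(5) w0 by simp
  moreover have "\<gamma>r (u t) \<le> w0"
    using monotone_onD[OF comp[OF assms(4)], of 0 t] t w0(1) by simp
  ultimately show ?thesis
    unfolding generalized_play_eq_reflect[OF assms(1-5) u t] by (simp add: min.commute)
qed

lemma generalized_play_mono:
  assumes "continuous_on UNIV \<gamma>l" "continuous_on UNIV \<gamma>r" "mono \<gamma>l" "mono \<gamma>r" "\<And>x. \<gamma>r x \<le> \<gamma>l x"
    and u: "continuous_on {0..} u" and t: "0 \<le> t" and incr: "mono_on {0..t} u"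
    and w0: "\<gamma>r (u 0) \<le> w0" "w0 \<le> \<gamma>l (u 0)"
  shows "generalized_play \<gamma>l \<gamma>r u w0 t = max w0 (\<gamma>r (u t))"
proof -
  have comp: "mono_on {0..t} (g \<circ> u)" if "mono g" for g :: "real \<Rightarrow> real"
    by (rule mono_onI) (simp add: monoD[OF that] mono_onD[OF incr])
  have "reflect (\<gamma>l \<circ> u) (\<gamma>r \<circ> u) w0 t =
      min (\<gamma>l (u t)) (max (\<gamma>r (u t)) (reflect (\<gamma>l \<circ> u) (\<gamma>r \<circ> u) w0 0))"
    using reflect_incr[of 0 t "\<gamma>r \<circ> u" "\<gamma>l \<circ> u" w0] t comp assms(3-5) by simp
  moreover have "reflect (\<gamma>l \<circ> u) (\<gamma>r \<circ> u) w0 0 = w0"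
    using reflect_zero[of "\<gamma>r \<circ> u" "\<gamma>l \<circ> u" w0] assms(5) w0 by simp
  moreover have "w0 \<le> \<gamma>l (u t)"
    using mono_onD[OF comp[OF assms(3)], of 0 t] t w0(2) by simp
  ultimately show ?thesis
    unfolding generalized_play_eq_reflect[OF assms(1-5) u t]
    using assms(5)[of "u t"] by (simp add: max.commute)
qed

lemma play_cauchy_solution_has_derivative:
  assumes "play_cauchy_solution \<gamma>l \<gamma>r K r u0 w0 u" "0 < K" "0 \<le> t"
  shows "(u has_real_derivative K * (r t - generalized_play \<gamma>l \<gamma>r u w0 t)) (at t within {0..})"
proof -
  obtain D where D: "(u has_real_derivative D) (at t within {0..})"
    "1 / K * D + generalized_play \<gamma>l \<gamma>r u w0 t = r t"
    using assms unfolding play_cauchy_solution_def by blast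
  have "D = K * (r t - generalized_play \<gamma>l \<gamma>r u w0 t)"
    using D(2) assms(2) by (simp add: field_simps)
  then show ?thesis using D(1) by simp
qed

lemma play_cauchy_solution_continuous:
  assumes "play_cauchy_solution \<gamma>l \<gamma>r K r u0 w0 u" "0 < K"
  shows "continuous_on {0..} u"
  by (rule DERIV_continuous_on[of _ _ "\<lambda>t. K * (r t - generalized_play \<gamma>l \<gamma>r u w0 t)"])
    (use play_cauchy_solution_has_derivative[OF assms] in auto)

lemma play_cauchy_solution_descending:
  assumes mono: "mono \<gamma>l" "mono \<gamma>r" and le: "\<And>x. \<gamma>r x \<le> \<gamma>l x"
    and lip: "C-lipschitz_on UNIV \<gamma>l" and cont: "continuous_on UNIV \<gamma>r" and K: "0 < K"
    and sol: "play_cauchy_solution \<gamma>l \<gamma>r K r u0 w0 u" and r: "\<And>t. 0 \<le> t \<Longrightarrow> r t = R"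
    and w0: "\<gamma>r u0 \<le> w0" "w0 \<le> \<gamma>l u0" "R < w0"
  shows "descending \<gamma>l K R w0 u"
proof -
  have u0: "u 0 = u0" using sol by (simp add: play_cauchy_solution_def)
  note contl = lipschitz_on_continuous_on[OF lip]
  note contu = play_cauchy_solution_continuous[OF sol K]
  show ?thesis
  proof (rule descendingI[OF mono(1) lip K])
    show "continuous_on {0..} (generalized_play \<gamma>l \<gamma>r u w0)"
      using is_generalized_play_generalized_play[OF contl cont mono le] contu
      unfolding is_generalized_play_def by blast
    show "(u has_real_derivative K * (R - generalized_play \<gamma>l \<gamma>r u w0 t)) (at t within {0..})"
      if "0 \<le> t" for t
      using play_cauchy_solution_has_derivative[OF sol K that] r[OF that] by simp
    show "generalized_play \<gamma>l \<gamma>r u w0 t = min w0 (\<gamma>l (u t))"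
      if "0 \<le> t" "antimono_on {0..t} u" for t
      by (rule generalized_play_antimono[OF contl cont mono le contu that]) (use w0 u0 in auto)
  qed (use w0 u0 in auto)
qed

text \<open>The mirror image: the reflected solution descends along the reflected curve.\<close>

lemma play_cauchy_solution_ascending:
  assumes mono: "mono \<gamma>l" "mono \<gamma>r" and le: "\<And>x. \<gamma>r x \<le> \<gamma>l x"
    and cont: "continuous_on UNIV \<gamma>l" and lip: "C-lipschitz_on UNIV \<gamma>r" and K: "0 < K"
    and sol: "play_cauchy_solution \<gamma>l \<gamma>r K r u0 w0 u" and r: "\<And>t. 0 \<le> t \<Longrightarrow> r t = R"
    and w0: "\<gamma>r u0 \<le> w0" "w0 \<le> \<gamma>l u0" "w0 < R"
  shows "descending (\<lambda>x. - \<gamma>r (- x)) K (- R) (- w0) (\<lambda>t. - u t)"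
proof -
  have u0: "u 0 = u0" using sol by (simp add: play_cauchy_solution_def)
  note contr = lipschitz_on_continuous_on[OF lip]
  note contu = play_cauchy_solution_continuous[OF sol K]
  show ?thesis
  proof (rule descendingI)
    show "mono (\<lambda>x. - \<gamma>r (- x))" using monoD[OF mono(2)] by (intro monoI) simp
    show "C-lipschitz_on UNIV (\<lambda>x. - \<gamma>r (- x))"
    proof (rule lipschitz_onI)
      show "dist (- \<gamma>r (- x)) (- \<gamma>r (- y)) \<le> C * dist x y" for x y
        using lipschitz_onD[OF lip, of "- x" "- y"] by (simp add: dist_minus)
    qed (rule lipschitz_on_nonneg[OF lip])
    show "continuous_on {0..} (\<lambda>t. - generalized_play \<gamma>l \<gamma>r u w0 t)"
      using is_generalized_play_generalized_play[OF cont contr mono le] contu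
      unfolding is_generalized_play_def by (intro continuous_on_minus) blast
    show "((\<lambda>t. - u t) has_real_derivative K * (- R - - generalized_play \<gamma>l \<gamma>r u w0 t))
        (at t within {0..})" if "0 \<le> t" for t
      using DERIV_minus[OF play_cauchy_solution_has_derivative[OF sol K that]] r[OF that]
      by (simp add: algebra_simps)
    show "- generalized_play \<gamma>l \<gamma>r u w0 t = min (- w0) (- \<gamma>r (- (- u t)))"
      if t: "0 \<le> t" and anti: "antimono_on {0..t} (\<lambda>t. - u t)" for t
    proof -
      have "mono_on {0..t} u"
        using anti by (simp add: monotone_on_def)
      then have "generalized_play \<gamma>l \<gamma>r u w0 t = max w0 (\<gamma>r (u t))"
        by (rule generalized_play_mono[OF cont contr mono le contu t]) (use w0 u0 in auto)
      then show ?thesis by simp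
    qed
  qed (use w0 u0 K in auto)
qed

theorem theorem4p4:
  fixes \<gamma>l \<gamma>r r u :: "real \<Rightarrow> real" and K R H u0 w0 u1 u2 :: real
  assumes "mono \<gamma>l" and "mono \<gamma>r"
    and "\<exists>C. C-lipschitz_on UNIV \<gamma>l" and "\<exists>C. C-lipschitz_on UNIV \<gamma>r"
    and "\<forall>x. \<gamma>r x \<le> \<gamma>l x"
    and "K > 0"
    and "\<gamma>r u0 \<le> w0" and "w0 \<le> \<gamma>l u0"
    and "\<forall>t\<ge>0. r t = R"
    and "play_cauchy_solution \<gamma>l \<gamma>r K r u0 w0 u"
    and "H > 0" and "\<forall>t\<ge>0. 0 \<le> generalized_play \<gamma>l \<gamma>r u w0 t \<and> generalized_play \<gamma>l \<gamma>r u w0 t \<le> H"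
    and "0 < R" and "R < H"
    and u1: "\<gamma>l u1 = R" "\<forall>x. \<gamma>l x = R \<longrightarrow> x \<le> u1"
    and u2: "\<gamma>r u2 = R" "\<forall>x. \<gamma>r x = R \<longrightarrow> u2 \<le> x"
    and nonequilibrium: "w0 \<noteq> R"
  shows "lyapunov_stable_solution \<gamma>l \<gamma>r K r u0 w0 u \<and>
         (\<exists>u_lim\<in>{u1, u2}. (u \<longlongrightarrow> u_lim) at_top)"
proof -
  obtain Cl Cr where lip: "Cl-lipschitz_on UNIV \<gamma>l" "Cr-lipschitz_on UNIV \<gamma>r"
    using assms(3,4) by blast
  note cont = lip[THEN lipschitz_on_continuous_on]
  have le: "\<gamma>r x \<le> \<gamma>l x" for x using assms(5) by blast
  have r: "r t = R" if "0 \<le> t" for t using assms(9) that by blast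
  have init: "v 0 = v0" if "play_cauchy_solution \<gamma>l \<gamma>r K r v0 z0 v" for v0 z0 v
    using that by (simp add: play_cauchy_solution_def)
  note K = \<open>K > 0\<close>
  note sol = assms(10)
  consider "R < w0" | "w0 < R" using nonequilibrium by linarith
  then show ?thesis
  proof cases
    case 1
    have desc: "descending \<gamma>l K R z0 v"
      if "\<gamma>r v0 \<le> z0" "z0 \<le> \<gamma>l v0" "R < z0" "play_cauchy_solution \<gamma>l \<gamma>r K r v0 z0 v" for v0 z0 v
      by (rule play_cauchy_solution_descending[OF assms(1,2) le lip(1) cont(2) K that(4) r that(1-3)])
    note u = desc[OF assms(7,8) 1 sol]
    have a: "\<gamma>l u1 = R" "\<And>x. \<gamma>l x = R \<Longrightarrow> x \<le> u1" using u1 by auto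
    have "lyapunov_stable_solution \<gamma>l \<gamma>r K r u0 w0 u"
      unfolding lyapunov_stable_solution_def
    proof (intro allI impI)
      fix \<epsilon> :: real assume "0 < \<epsilon>"
      then obtain \<delta> where \<delta>: "0 < \<delta>"
        "\<And>z' v' t. descending \<gamma>l K R z' v' \<Longrightarrow> \<bar>v' 0 - u 0\<bar> + \<bar>z' - w0\<bar> < \<delta> \<Longrightarrow> 0 \<le> t \<Longrightarrow>
          \<bar>v' t - u t\<bar> < \<epsilon>"
        using descending_stable[OF u assms(1) K a] by blast
      \<comment> \<open>The bound \<open>w0 - R\<close> keeps the perturbed initial output on the same side of \<open>R\<close>.\<close>
      show "\<exists>\<delta>>0. \<forall>v0 z0 v. \<gamma>r v0 \<le> z0 \<longrightarrow> z0 \<le> \<gamma>l v0 \<longrightarrow> \<bar>v0 - u0\<bar> + \<bar>z0 - w0\<bar> < \<delta> \<longrightarrow>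
          play_cauchy_solution \<gamma>l \<gamma>r K r v0 z0 v \<longrightarrow> (\<forall>t\<ge>0. \<bar>v t - u t\<bar> < \<epsilon>)"
      proof (intro exI[of _ "min \<delta> (w0 - R)"] conjI allI impI)
        fix v0 z0 v t
        assume v: "\<gamma>r v0 \<le> z0" "z0 \<le> \<gamma>l v0" "\<bar>v0 - u0\<bar> + \<bar>z0 - w0\<bar> < min \<delta> (w0 - R)"
          "play_cauchy_solution \<gamma>l \<gamma>r K r v0 z0 v" "(0::real) \<le> t"
        have "R < z0" using v(3) by linarith
        then have "descending \<gamma>l K R z0 v" using desc v by blast
        then show "\<bar>v t - u t\<bar> < \<epsilon>"
          by (rule \<delta>(2)) (use v init[OF v(4)] init[OF sol] in auto)
      qed (use \<delta>(1) 1 in auto)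
    qed
    moreover have "(u \<longlongrightarrow> u1) at_top" by (rule descending_tendsto[OF u assms(1) K a])
    ultimately show ?thesis by blast
  next
    case 2
    let ?g = "\<lambda>x. - \<gamma>r (- x)"
    have desc: "descending ?g K (- R) (- z0) (\<lambda>t. - v t)"
      if "\<gamma>r v0 \<le> z0" "z0 \<le> \<gamma>l v0" "z0 < R" "play_cauchy_solution \<gamma>l \<gamma>r K r v0 z0 v" for v0 z0 v
      by (rule play_cauchy_solution_ascending[OF assms(1,2) le cont(1) lip(2) K that(4) r that(1-3)])
    note u = desc[OF assms(7,8) 2 sol]
    have g: "mono ?g" using monoD[OF assms(2)] by (intro monoI) simp
    have a: "?g (- u2) = - R" "\<And>x. ?g x = - R \<Longrightarrow> x \<le> - u2" using u2 by force+
    have "lyapunov_stable_solution \<gamma>l \<gamma>r K r u0 w0 u"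
      unfolding lyapunov_stable_solution_def
    proof (intro allI impI)
      fix \<epsilon> :: real assume "0 < \<epsilon>"
      then obtain \<delta> where \<delta>: "0 < \<delta>"
        "\<And>z' v' t. descending ?g K (- R) z' v' \<Longrightarrow> \<bar>v' 0 - - u 0\<bar> + \<bar>z' - - w0\<bar> < \<delta> \<Longrightarrow> 0 \<le> t \<Longrightarrow>
          \<bar>v' t - - u t\<bar> < \<epsilon>"
        using descending_stable[OF u g K a] by blast
      show "\<exists>\<delta>>0. \<forall>v0 z0 v. \<gamma>r v0 \<le> z0 \<longrightarrow> z0 \<le> \<gamma>l v0 \<longrightarrow> \<bar>v0 - u0\<bar> + \<bar>z0 - w0\<bar> < \<delta> \<longrightarrow>
          play_cauchy_solution \<gamma>l \<gamma>r K r v0 z0 v \<longrightarrow> (\<forall>t\<ge>0. \<bar>v t - u t\<bar> < \<epsilon>)"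
      proof (intro exI[of _ "min \<delta> (R - w0)"] conjI allI impI)
        fix v0 z0 v t
        assume v: "\<gamma>r v0 \<le> z0" "z0 \<le> \<gamma>l v0" "\<bar>v0 - u0\<bar> + \<bar>z0 - w0\<bar> < min \<delta> (R - w0)"
          "play_cauchy_solution \<gamma>l \<gamma>r K r v0 z0 v" "(0::real) \<le> t"
        have "z0 < R" using v(3) by linarith
        then have "descending ?g K (- R) (- z0) (\<lambda>t. - v t)" using desc v by blast
        then have "\<bar>- v t - - u t\<bar> < \<epsilon>"
          by (rule \<delta>(2)) (use v init[OF v(4)] init[OF sol] in auto)
        then show "\<bar>v t - u t\<bar> < \<epsilon>" by linarith
      qed (use \<delta>(1) 2 in auto)
    qed
    moreover have "(u \<longlongrightarrow> u2) at_top"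
      using tendsto_minus[OF descending_tendsto[OF u g K a]] by simp
    ultimately show ?thesis by blast
  qed
qed

end
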